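(* Let $\mathfrak A$ be both an HTG and an ordered vector space (over $\mathbb R$, with the same underlying addition). Suppose the set $\{x\in\mathfrak A: x\ge 0\}$ is sequentially closed in $\mathfrak A$ and $x\mapsto kx$ is a continuous map from $\mathfrak A$ to itself for every $k\in\mathbb R$. Let $\mathcal Q$ be a $\sigma$-ring. Then $\mathcal M(\mathcal Q,\mathfrak A)$ is an ordered vector space.
   Context: Monoids and groups are Abelian and written additively. An HTM is a monoid with a Hausdorff topology making addition continuous; an HTG is a group with a Hausdorff topology making addition and inversion continuous. For a map $f$, $D_f$ denotes its domain. "Countable" includes finite and empty. A subset is sequentially closed if it contains every limit of a convergent sequence of its elements. An ordered monoid is a monoid that is also a partially ordered set, such that $x\le y$ implies $x+z\le y+z$ for all $x,y,z$. An ordered vector space is an $\mathbb R$-vector space that is also an ordered monoid (for its addition) and such that $kx\ge0$ whenever $x\ge0$ and $k\in\mathbb R$, $k\ge0$. A ring (of sets) is a nonempty set $\mathcal Q$ of sets such that $A\cup B\in\mathcal Q$ and $A\setminus B\in\mathcal Q$ for all $A,B\in\mathcal Q$. A $\delta$-ring is a ring closed under intersections of nonempty countable families; a $\sigma$-ring is a ring closed under countable unions. For a set of sets $\mathcal K$, $\sigma(\mathcal K)$ is the smallest $\sigma$-ring containing $\mathcal K$. A family $\mathbf A\colon I\to\mathcal Q$ is a partition of $A$ (into elements of $\mathcal Q$) if $\mathbf A(i)\cap\mathbf A(j)=\varnothing$ for $i\ne j$ and $\bigcup_{i\in I}\mathbf A(i)=A$ (members may be empty and $I$ may be empty); it is countable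 if $I$ is countable. A family $f\colon I\to\mathfrak A$ in an HTM is summable in $\mathfrak A$ if the net $J\mapsto\sum_{i\in J}f(i)$ over the finite subsets $J\subset I$, directed by inclusion, converges in $\mathfrak A$; its limit is denoted $\sum f$. An $\mathfrak A$-valued premeasure is a map $\mu\colon D_\mu\to\mathfrak A$ whose domain $D_\mu$ is a $\delta$-ring and such that for every $A\in D_\mu$ and every countable partition $\mathbf A$ of $A$ into elements of $D_\mu$, the family $\mu\circ\mathbf A$ is summable in $\mathfrak A$ and $\mu(A)=\sum\mu\circ\mathbf A$. The host $\sigma$-ring of a map $\mu$ is $\mathscr H[\mu]=\sigma(D_\mu)$. Maps $\mu,\nu$ are similar, $\mu\asymp\nu$, if $\mathscr H[\mu]=\mathscr H[\nu]$ and $\mu,\nu$ coincide on $D_\mu\cap D_\nu$. An $\mathfrak A$-valued measure is an $\mathfrak A$-valued premeasure $\mu$ which is an extension of every $\mathfrak A$-valued premeasure $\nu$ with $\nu\asymp\mu$. For every $\mathfrak A$-valued premeasure $\mu$ there is a unique $\mathfrak A$-valued measure similar to $\mu$; it is denoted $[\![\mu]\!]_{\mathfrak A}$. $\mathcal M(\mathcal Q,\mathfrak A)$ is the set of all $\mathfrak A$-valued measures $\mu$ with $\mathscr H[\mu]=\mathcal Q$, endowed with the addition $\mu+\nu=[\![\mu\dotplus\nu]\!]_{\mathfrak A}$, where $\mu\dotplus\nu$ is the pointwise sum defined on $D_\mu\cap D_\nu$, with the scalar multiplication $k\mu=[\![k\cdot\mu]\!]_{\mathfrak A}$, where $k\cdot\mu$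 is the pointwise multiple $A\mapsto k\mu(A)$ on $D_\mu$, and with the relation $\mu\le\nu$ if and only if $\mu(A)\le\nu(A)$ for every $A\in D_\mu\cap D_\nu$. *)

theory Defs
  imports "HOL-Analysis.Analysis" "HOL-Algebra.Algebraic_Closure_Type"
begin

section \<open>Rings of sets\<close>

definition delta_ring_of_sets :: "'x set set \<Rightarrow> bool" where
  "delta_ring_of_sets Q \<longleftrightarrow>
     ring_of_sets UNIV Q \<and> (\<forall>C. C \<subseteq> Q \<and> C \<noteq> {} \<and> countable C \<longrightarrow> \<Inter>C \<in> Q)"

definition sigma_ring_of_sets :: "'x set set \<Rightarrow> bool" where
  "sigma_ring_of_sets Q \<longleftrightarrow>
     ring_of_sets UNIV Q \<and> (\<forall>C. C \<subseteq> Q \<and> countable C \<longrightarrow> \<Union>C \<in> Q)"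

section \<open>Premeasures and measures\<close>

text \<open>
  A map \<open>\<mu>\<close> defined on a set of sets is a partial function, with domain \<^term>\<open>dom \<mu>\<close>;
  \<open>\<mu>\<close> extends \<open>\<nu>\<close> iff \<^term>\<open>\<nu> \<subseteq>\<^sub>m \<mu>\<close>. An Abelian Hausdorff topological monoid is a type
  of sort \<open>{topological_comm_monoid_add, t2_space}\<close>.
\<close>

text \<open>
  Every countable family of sets can be reindexed by a set of natural numbers, so the
  index sets range over the subsets of \<^typ>\<open>nat\<close>. The predicate \<^const>\<open>has_sum\<close> is
  convergence of the net of finite partial sums.
\<close>

definition premeasure ::
  "('x set \<rightharpoonup> 'a :: {topological_comm_monoid_add, t2_space}) \<Rightarrow> bool" where
  "premeasure \<mu> \<longleftrightarrow>
     delta_ring_of_sets (dom \<mu>) \<and>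
     (\<forall>A \<in> dom \<mu>. \<forall>(I :: nat set) P.
        (\<forall>i\<in>I. P i \<in> dom \<mu>) \<and> disjoint_family_on P I \<and> (\<Union>i\<in>I. P i) = A \<longrightarrow>
        ((\<lambda>i. the (\<mu> (P i))) has_sum the (\<mu> A)) I)"

definition host_sigma_ring :: "('x set \<rightharpoonup> 'a) \<Rightarrow> 'x set set" where
  "host_sigma_ring \<mu> = sigma_ring_of_sets hull dom \<mu>"

definition similar :: "('x set \<rightharpoonup> 'a) \<Rightarrow> ('x set \<rightharpoonup> 'a) \<Rightarrow> bool" where
  "similar \<mu> \<nu> \<longleftrightarrow>
     host_sigma_ring \<mu> = host_sigma_ring \<nu> \<and> (\<forall>A \<in> dom \<mu> \<inter> dom \<nu>. \<mu> A = \<nu> A)"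

definition maximal_measure ::
  "('x set \<rightharpoonup> 'a :: {topological_comm_monoid_add, t2_space}) \<Rightarrow> bool" where
  "maximal_measure \<mu> \<longleftrightarrow>
     premeasure \<mu> \<and> (\<forall>\<nu>. premeasure \<nu> \<and> similar \<nu> \<mu> \<longrightarrow> \<nu> \<subseteq>\<^sub>m \<mu>)"

definition generated_measure ::
  "('x set \<rightharpoonup> 'a :: {topological_comm_monoid_add, t2_space}) \<Rightarrow> ('x set \<rightharpoonup> 'a)" where
  "generated_measure \<mu> = (THE \<nu>. maximal_measure \<nu> \<and> similar \<nu> \<mu>)"

section \<open>The structure on the set of measures with a given host\<close>

definition measures_on ::
  "'x set set \<Rightarrow> ('x set \<rightharpoonup> 'a :: {topological_comm_monoid_add, t2_space}) set" where
  "measures_on Q = {\<mu>. maximal_measure \<mu> \<and> host_sigma_ring \<mu> = Q}"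

definition pointwise_add ::
  "('x set \<rightharpoonup> 'a :: plus) \<Rightarrow> ('x set \<rightharpoonup> 'a) \<Rightarrow> ('x set \<rightharpoonup> 'a)" where
  "pointwise_add \<mu> \<nu> =
     (\<lambda>A. if A \<in> dom \<mu> \<inter> dom \<nu> then Some (the (\<mu> A) + the (\<nu> A)) else None)"

definition pointwise_scale ::
  "real \<Rightarrow> ('x set \<rightharpoonup> 'a :: real_vector) \<Rightarrow> ('x set \<rightharpoonup> 'a)" where
  "pointwise_scale k \<mu> = (\<lambda>A. map_option (\<lambda>x. k *\<^sub>R x) (\<mu> A))"

definition measure_add ::
  "('x set \<rightharpoonup> 'a :: {topological_comm_monoid_add, t2_space}) \<Rightarrow>
     ('x set \<rightharpoonup> 'a) \<Rightarrow> ('x set \<rightharpoonup> 'a)" where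
  "measure_add \<mu> \<nu> = generated_measure (pointwise_add \<mu> \<nu>)"

definition measure_scale ::
  "real \<Rightarrow> ('x set \<rightharpoonup> 'a :: {real_vector, topological_comm_monoid_add, t2_space}) \<Rightarrow>
     ('x set \<rightharpoonup> 'a)" where
  "measure_scale k \<mu> = generated_measure (pointwise_scale k \<mu>)"

definition measure_le :: "('x set \<rightharpoonup> 'a :: ord) \<Rightarrow> ('x set \<rightharpoonup> 'a) \<Rightarrow> bool" where
  "measure_le \<mu> \<nu> \<longleftrightarrow> (\<forall>A \<in> dom \<mu> \<inter> dom \<nu>. the (\<mu> A) \<le> the (\<nu> A))"

section \<open>Ordered vector spaces and sequentially closed sets\<close>

text \<open>
  A real vector space is a module over the field of real numbers. The zero vector is not
  part of the given data but asserted to exist. The fields \<^const>\<open>monoid.mult\<close> and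
  \<^const>\<open>one\<close> of a module record play no role for modules.
\<close>

definition ordered_vector_space_on ::
  "'v set \<Rightarrow> ('v \<Rightarrow> 'v \<Rightarrow> 'v) \<Rightarrow> (real \<Rightarrow> 'v \<Rightarrow> 'v) \<Rightarrow> ('v \<Rightarrow> 'v \<Rightarrow> bool) \<Rightarrow> bool" where
  "ordered_vector_space_on V add_V scale_V le_V \<longleftrightarrow>
     reflp_on V le_V \<and> transp_on V le_V \<and> antisymp_on V le_V \<and>
     (\<forall>x\<in>V. \<forall>y\<in>V. \<forall>w\<in>V. le_V x y \<longrightarrow> le_V (add_V x w) (add_V y w)) \<and>
     (\<exists>z.
        Module.module (ring_of_type_algebra :: real ring)
          \<lparr>carrier = V, monoid.mult = undefined, one = undefined,
           zero = z, add = add_V, smult = scale_V\<rparr> \<and>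
        (\<forall>k\<ge>0. \<forall>x\<in>V. le_V z x \<longrightarrow> le_V z (scale_V k x)))"

definition sequentially_closed :: "'a :: topological_space set \<Rightarrow> bool" where
  "sequentially_closed S \<longleftrightarrow> (\<forall>s l. (\<forall>n. s n \<in> S) \<and> s \<longlonglongrightarrow> l \<longrightarrow> l \<in> S)"

end

theory Submission
  imports Defs
begin

text \<open>
  A \<open>\<delta>\<close>-ring is an ideal of the \<open>\<sigma>\<close>-ring it generates, so the \<open>\<delta>\<close>-rings with host \<open>Q\<close> are the
  ideals of \<open>Q\<close> that cover every element of \<open>Q\<close> countably, and these are closed under
  intersection. If an equation or inequality between two premeasures holds on such an ideal, then
  it holds on the whole common domain: cut a set into countably many pieces from the ideal and
  pass to the limit, using sequential closedness of the positive cone for inequalities. Hence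
  similarity is an equivalence relation on the premeasures with host \<open>Q\<close>, and each class contains
  exactly one measure: it is defined at \<open>A\<close> iff some countably additive function on the elements of
  \<open>Q\<close> below \<open>A\<close> agrees with a given premeasure of the class wherever both are defined. So every
  axiom needs to be checked only pointwise, on the intersection of the domains involved.
\<close>

section \<open>Delta-rings as ideals of sigma-rings\<close>

text \<open>The empty family gives \<open>{}\<close> and two-element families give binary unions.
  What remains are pure closure conditions, which pass to intersections, as \<open>hull\<close>
  requires.\<close>

lemma sigma_ring_of_sets_iff:
  "sigma_ring_of_sets Q \<longleftrightarrow>
     (\<forall>A\<in>Q. \<forall>B\<in>Q. A - B \<in> Q) \<and> (\<forall>C. C \<subseteq> Q \<and> countable C \<longrightarrow> \<Union>C \<in> Q)"
proof
  assume R: "(\<forall>A\<in>Q. \<forall>B\<in>Q. A - B \<in> Q) \<and> (\<forall>C. C \<subseteq> Q \<and> countable C \<longrightarrow> \<Union>C \<in> Q)"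
  have "{} \<in> Q"
    using R[THEN conjunct2, rule_format, of "{}"] by simp
  moreover have "A \<union> B \<in> Q" if "A \<in> Q" "B \<in> Q" for A B
    using R[THEN conjunct2, rule_format, of "{A, B}"] that by simp
  ultimately show "sigma_ring_of_sets Q"
    using R by (simp add: sigma_ring_of_sets_def ring_of_sets_iff)
qed (auto simp: sigma_ring_of_sets_def ring_of_sets_iff)

lemma sigma_ring_of_sets_Inter:
  assumes "\<And>Q. Q \<in> T \<Longrightarrow> sigma_ring_of_sets Q"
  shows "sigma_ring_of_sets (\<Inter>T)"
  using assms by (simp add: sigma_ring_of_sets_iff le_Inf_iff Ball_def)

lemma sigma_ring_of_sets_hull: "sigma_ring_of_sets (sigma_ring_of_sets hull D)"
  by (rule hull_in, rule sigma_ring_of_sets_Inter) simp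

text \<open>Over a sigma-ring \<open>Q\<close> these are exactly the delta-rings that generate
  \<open>Q\<close>, see \<open>generating_ideal_iff\<close>. Countable covers stand in for
  generation, so that no hull has to be handled when domains are intersected.\<close>

definition generating_ideal :: "'x set set \<Rightarrow> 'x set set \<Rightarrow> bool" where
  "generating_ideal Q D \<longleftrightarrow>
     D \<subseteq> Q \<and> {} \<in> D \<and> (\<forall>A\<in>D. \<forall>B\<in>D. A \<union> B \<in> D) \<and> (\<forall>A\<in>D. \<forall>B\<in>Q. B \<subseteq> A \<longrightarrow> B \<in> D) \<and>
     (\<forall>W\<in>Q. \<exists>C. C \<subseteq> D \<and> countable C \<and> W \<subseteq> \<Union>C)"

lemma generating_idealD:
  assumes "generating_ideal Q D"
  shows "D \<subseteq> Q" "{} \<in> D" "A \<in> D \<Longrightarrow> B \<in> D \<Longrightarrow> A \<union> B \<in> D"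
    "A \<in> D \<Longrightarrow> B \<in> Q \<Longrightarrow> B \<subseteq> A \<Longrightarrow> B \<in> D"
    "W \<in> Q \<Longrightarrow> \<exists>C. C \<subseteq> D \<and> countable C \<and> W \<subseteq> \<Union>C"
  using assms by (simp_all add: generating_ideal_def)

text \<open>The sets whose trace on every member of \<open>D\<close> lies in \<open>D\<close> form a
  sigma-ring containing \<open>D\<close>, hence include the whole hull.\<close>

lemma delta_ring_Int_hull:
  assumes D: "delta_ring_of_sets D" and A: "A \<in> D" and B: "B \<in> sigma_ring_of_sets hull D"
  shows "B \<inter> A \<in> D"
proof -
  have ring: "W - Y \<in> D" "W \<union> Y \<in> D" if "W \<in> D" "Y \<in> D" for W Y
    using D that by (auto simp: delta_ring_of_sets_def ring_of_sets_iff)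
  have inter: "\<Inter>C \<in> D" if "C \<subseteq> D" "C \<noteq> {}" "countable C" for C
    using D that by (auto simp: delta_ring_of_sets_def)
  have "B \<inter> A \<in> D" if "B \<in> D" "A \<in> D" for A B
    using inter[of "{B, A}"] that by simp
  moreover have "sigma_ring_of_sets {B. \<forall>A\<in>D. B \<inter> A \<in> D}"
    unfolding sigma_ring_of_sets_iff
  proof (intro conjI ballI allI impI)
    fix W Y assume XY: "W \<in> {B. \<forall>A\<in>D. B \<inter> A \<in> D}" "Y \<in> {B. \<forall>A\<in>D. B \<inter> A \<in> D}"
    have "(W - Y) \<inter> A = W \<inter> A - Y \<inter> A" for A
      by blast
    then show "W - Y \<in> {B. \<forall>A\<in>D. B \<inter> A \<in> D}"
      using XY ring(1) by simp
  next
    fix C assume C: "C \<subseteq> {B. \<forall>A\<in>D. B \<inter> A \<in> D} \<and> countable C"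
    have "\<Union>C \<inter> A \<in> D" if A: "A \<in> D" for A
    proof (cases "C = {}")
      case True
      then show ?thesis
        using D by (simp add: delta_ring_of_sets_def ring_of_sets_iff)
    next
      case False
      \<comment> \<open>De Morgan relative to \<open>A\<close> turns the union into an intersection;
        the empty family is split off because a delta-ring is closed only under nonempty countable
        intersections.\<close>
      have "(\<Inter>B\<in>C. A - B \<inter> A) \<in> D"
        using C A False ring(1) by (intro inter) auto
      then have "A - (\<Inter>B\<in>C. A - B \<inter> A) \<in> D"
        using A ring(1) by blast
      also have "A - (\<Inter>B\<in>C. A - B \<inter> A) = \<Union>C \<inter> A"
        by auto
      finally show ?thesis .
    qed
    then show "\<Union>C \<in> {B. \<forall>A\<in>D. B \<inter> A \<in> D}"
      by blast
  qed
  ultimately have "sigma_ring_of_sets hull D \<subseteq> {B. \<forall>A\<in>D. B \<inter> A \<in> D}"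
    by (intro hull_minimal) auto
  with A B show ?thesis
    by blast
qed

text \<open>Sets with a countable cover from \<open>D\<close> form a sigma-ring: a difference
  inherits the cover of its minuend, and countably many chosen covers merge into one.\<close>

lemma sigma_hull_countable_cover:
  assumes "W \<in> sigma_ring_of_sets hull D"
  shows "\<exists>C. C \<subseteq> D \<and> countable C \<and> W \<subseteq> \<Union>C"
proof -
  let ?S = "{W. \<exists>C. C \<subseteq> D \<and> countable C \<and> W \<subseteq> \<Union>C}"
  have "sigma_ring_of_sets ?S"
    unfolding sigma_ring_of_sets_iff
  proof (intro conjI ballI allI impI)
    fix E assume E: "E \<subseteq> ?S \<and> countable E"
    then have "\<forall>W\<in>E. \<exists>C. C \<subseteq> D \<and> countable C \<and> W \<subseteq> \<Union>C"
      by blast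
    from bchoice[OF this] obtain F
      where F: "\<forall>W\<in>E. F W \<subseteq> D \<and> countable (F W) \<and> W \<subseteq> \<Union>(F W)" ..
    have "(\<Union>W\<in>E. F W) \<subseteq> D"
      using F by (simp add: UN_least)
    moreover have "\<Union>E \<subseteq> \<Union>(\<Union>W\<in>E. F W)"
    proof (rule Union_least)
      fix W assume W: "W \<in> E"
      then have "W \<subseteq> \<Union>(F W)"
        using F by simp
      also have "\<Union>(F W) \<subseteq> \<Union>(\<Union>W\<in>E. F W)"
        using W by (intro Union_mono UN_upper)
      finally show "W \<subseteq> \<Union>(\<Union>W\<in>E. F W)" .
    qed
    moreover have "countable (\<Union>W\<in>E. F W)"
      using E F by (intro countable_UN) simp_all
    ultimately show "\<Union>E \<in> ?S"
      by blast
  qed blast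
  moreover have "D \<subseteq> ?S"
  proof
    fix A assume "A \<in> D"
    then show "A \<in> ?S"
      by (auto intro!: exI[of _ "{A}"])
  qed
  ultimately have "sigma_ring_of_sets hull D \<subseteq> ?S"
    by (intro hull_minimal)
  with assms show ?thesis
    by blast
qed

section \<open>Sets, ideals and partitions inside a fixed sigma-ring\<close>

locale sigma_ring =
  fixes Q :: "'x set set"
  assumes sigma_ring: "sigma_ring_of_sets Q"
begin

lemma Diff_in: "A \<in> Q \<Longrightarrow> B \<in> Q \<Longrightarrow> A - B \<in> Q"
  and Union_in: "C \<subseteq> Q \<Longrightarrow> countable C \<Longrightarrow> \<Union>C \<in> Q"
  using sigma_ring by (auto simp: sigma_ring_of_sets_iff)

lemma empty_in: "{} \<in> Q"
  using Union_in[of "{}"] by simp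

lemma Un_in: "A \<in> Q \<Longrightarrow> B \<in> Q \<Longrightarrow> A \<union> B \<in> Q"
  using Union_in[of "{A, B}"] by simp

lemma Int_in: "A \<in> Q \<Longrightarrow> B \<in> Q \<Longrightarrow> A \<inter> B \<in> Q"
  using Diff_in[of A "A - B"] Diff_in[of A B] by (simp add: Diff_Diff_Int)

lemma Inter_in:
  assumes "C \<subseteq> Q" "C \<noteq> {}" "countable C"
  shows "\<Inter>C \<in> Q"
proof -
  obtain A where A: "A \<in> C"
    using assms(2) by blast
  have "(\<Union>B\<in>C. A - B) \<in> Q"
    using assms A by (intro Union_in) (auto intro: Diff_in)
  then have "A - (\<Union>B\<in>C. A - B) \<in> Q"
    using A assms(1) by (blast intro: Diff_in)
  also have "A - (\<Union>B\<in>C. A - B) = \<Inter>C"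
    using A by blast
  finally show ?thesis .
qed

lemma generating_ideal_self: "generating_ideal Q Q"
  unfolding generating_ideal_def
proof (intro conjI ballI impI)
  fix W assume "W \<in> Q"
  then show "\<exists>C\<subseteq>Q. countable C \<and> W \<subseteq> \<Union>C"
    by (intro exI[of _ "{W}"]) simp
qed (auto intro: empty_in Un_in)

lemma generating_ideal_imp_delta_ring:
  assumes D: "generating_ideal Q D"
  shows "delta_ring_of_sets D"
proof -
  note DQ = generating_idealD(1)[OF D] and ideal = generating_idealD(4)[OF D]
  have "\<Inter>C \<in> D" if C: "C \<subseteq> D" "C \<noteq> {}" "countable C" for C
  proof -
    obtain A where A: "A \<in> C"
      using C by blast
    show ?thesis
    proof (rule ideal)
      show "A \<in> D" "\<Inter>C \<subseteq> A"
        using A C by blast+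
      show "\<Inter>C \<in> Q"
        using C DQ by (intro Inter_in) auto
    qed
  qed
  moreover have "A - B \<in> D" if "A \<in> D" "B \<in> D" for A B
    using that DQ by (intro ideal[OF that(1)] Diff_in) auto
  ultimately show ?thesis
    using D by (auto simp: delta_ring_of_sets_def ring_of_sets_iff generating_ideal_def)
qed

text \<open>Enumerate a countable cover, cut every member down to \<open>W\<close> and make the
  sequence disjoint.\<close>

lemma generating_ideal_partition:
  assumes D: "generating_ideal Q D" and W: "W \<in> Q"
  obtains P :: "nat \<Rightarrow> 'x set" where "\<And>i. P i \<in> D" "disjoint_family P" "(\<Union>i. P i) = W"
proof -
  obtain C where C: "C \<subseteq> D" "countable C" "W \<subseteq> \<Union>C"
    using generating_idealD(5)[OF D W] by blast
  note DQ = generating_idealD(1,2)[OF D] and ideal = generating_idealD(4)[OF D]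
  interpret ring_of_sets UNIV D
    using generating_ideal_imp_delta_ring[OF D] by (simp add: delta_ring_of_sets_def)
  \<comment> \<open>Inserting \<open>{}\<close> keeps the enumerated set nonempty, so that
    \<open>from_nat_into\<close> ranges over exactly this set even when \<open>C\<close> is empty;
    the union is unaffected.\<close>
  define R where "R i = from_nat_into (insert {} C) i \<inter> W" for i
  have C': "from_nat_into (insert {} C) i \<in> D" for i
    using from_nat_into[of "insert {} C" i] C DQ by auto
  then have "R i \<in> D" for i
    unfolding R_def using C' DQ W by (intro ideal[OF C'[of i]] Int_in) auto
  then have "range (disjointed R) \<subseteq> D"
    by (intro range_disjointed_sets) auto
  moreover have "(\<Union>i. R i) = \<Union>(range (from_nat_into (insert {} C))) \<inter> W"
    by (auto simp: R_def)
  then have "(\<Union>i. R i) = W"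
    using C by (subst (asm) range_from_nat_into) auto
  ultimately show thesis
    using that[of "disjointed R"] by (auto simp: disjoint_family_disjointed UN_disjointed_eq)
qed

lemma generating_ideal_hull:
  assumes D: "generating_ideal Q D"
  shows "sigma_ring_of_sets hull D = Q"
proof
  show "sigma_ring_of_sets hull D \<subseteq> Q"
    using D sigma_ring by (intro hull_minimal) (auto simp: generating_ideal_def)
  show "Q \<subseteq> sigma_ring_of_sets hull D"
  proof
    fix W assume "W \<in> Q"
    then obtain P :: "nat \<Rightarrow> 'x set" where P: "\<And>i. P i \<in> D" "(\<Union>i. P i) = W"
      using generating_ideal_partition[OF D, of W] by metis
    then have "range P \<subseteq> sigma_ring_of_sets hull D"
      by (auto intro: hull_inc)
    then have "\<Union>(range P) \<in> sigma_ring_of_sets hull D"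
      using sigma_ring_of_sets_iff[THEN iffD1, OF sigma_ring_of_sets_hull[of D],
          THEN conjunct2, rule_format, of "range P"] by simp
    with P show "W \<in> sigma_ring_of_sets hull D"
      by simp
  qed
qed

text \<open>From right to left, a subset \<open>B\<close> of \<open>A\<close> equals its trace on
  \<open>A\<close>, so \<open>delta_ring_Int_hull\<close> gives the ideal property and
  \<open>sigma_hull_countable_cover\<close> the covers.\<close>

lemma generating_ideal_iff:
  "generating_ideal Q D \<longleftrightarrow> delta_ring_of_sets D \<and> sigma_ring_of_sets hull D = Q"
proof
  assume R: "delta_ring_of_sets D \<and> sigma_ring_of_sets hull D = Q"
  show "generating_ideal Q D"
    unfolding generating_ideal_def
  proof (intro conjI ballI impI)
    show "D \<subseteq> Q"
      using R hull_subset[of D sigma_ring_of_sets] by simp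
    show "{} \<in> D" and "\<And>A B. A \<in> D \<Longrightarrow> B \<in> D \<Longrightarrow> A \<union> B \<in> D"
      using R by (auto simp: delta_ring_of_sets_def ring_of_sets_iff)
    show "B \<in> D" if "A \<in> D" "B \<in> Q" "B \<subseteq> A" for A B
      using delta_ring_Int_hull[of D A B] R that by (simp add: Int_absorb2)
    show "\<exists>C\<subseteq>D. countable C \<and> W \<subseteq> \<Union>C" if "W \<in> Q" for W
      using R that by (intro sigma_hull_countable_cover) simp
  qed
qed (simp add: generating_ideal_hull generating_ideal_imp_delta_ring)

text \<open>Pairwise intersections of two covers cover again, and each \<open>a \<inter> b\<close>
  lies below a member of \<open>D\<close> and a member of \<open>E\<close>. Hence finitely many
  premeasures share a domain that still generates \<open>Q\<close>.\<close>

lemma generating_ideal_Int: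
  assumes D: "generating_ideal Q D" and E: "generating_ideal Q E"
  shows "generating_ideal Q (D \<inter> E)"
  unfolding generating_ideal_def
proof (intro conjI ballI impI)
  fix W assume W: "W \<in> Q"
  obtain A B where A: "A \<subseteq> D" "countable A" "W \<subseteq> \<Union>A" and B: "B \<subseteq> E" "countable B" "W \<subseteq> \<Union>B"
    using generating_idealD(5)[OF D W] generating_idealD(5)[OF E W] by blast
  let ?C = "(\<lambda>(a, b). a \<inter> b) ` (A \<times> B)"
  have "?C \<subseteq> D \<inter> E"
  proof -
    have "a \<inter> b \<in> D \<inter> E" if "a \<in> A" "b \<in> B" for a b
    proof -
      have ab: "a \<in> D" "b \<in> E"
        using A B that by auto
      then have "a \<inter> b \<in> Q"
        using generating_idealD(1)[OF D] generating_idealD(1)[OF E] by (auto intro: Int_in)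
      with ab show ?thesis
        using generating_idealD(4)[OF D, of a] generating_idealD(4)[OF E, of b] by simp
    qed
    then show ?thesis
      by auto
  qed
  moreover have "W \<subseteq> \<Union>?C"
  proof
    fix x assume "x \<in> W"
    then obtain a b where "a \<in> A" "x \<in> a" "b \<in> B" "x \<in> b"
      using A B by blast
    then show "x \<in> \<Union>?C"
      by force
  qed
  moreover have "countable ?C"
    using A B by blast
  ultimately show "\<exists>C\<subseteq>D \<inter> E. countable C \<and> W \<subseteq> \<Union>C"
    by blast
qed (use D E in \<open>auto simp: generating_ideal_def\<close>)

end

section \<open>Countably additive functions\<close>

text \<open>The additivity clause of \<open>premeasure\<close>, freed from partial maps, so that it
  can be restricted to smaller set systems and applied to candidate extensions.\<close>

definition sigma_additive_on ::
  "'x set set \<Rightarrow> ('x set \<Rightarrow> 'a :: {topological_comm_monoid_add, t2_space}) \<Rightarrow> bool" where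
  "sigma_additive_on D f \<longleftrightarrow>
     (\<forall>A\<in>D. \<forall>(I :: nat set) P. (\<forall>i\<in>I. P i \<in> D) \<and> disjoint_family_on P I \<and> (\<Union>i\<in>I. P i) = A \<longrightarrow>
        ((\<lambda>i. f (P i)) has_sum f A) I)"

lemma sigma_additive_onD:
  fixes I :: "nat set"
  assumes "sigma_additive_on D f" "A \<in> D" "\<And>i. i \<in> I \<Longrightarrow> P i \<in> D" "disjoint_family_on P I"
    "(\<Union>i\<in>I. P i) = A"
  shows "((\<lambda>i. f (P i)) has_sum f A) I"
  using assms unfolding sigma_additive_on_def by blast

lemma sigma_additive_on_subset: "sigma_additive_on D f \<Longrightarrow> E \<subseteq> D \<Longrightarrow> sigma_additive_on E f"
  unfolding sigma_additive_on_def by (meson subsetD)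

lemma sigma_additive_on_cong:
  assumes "\<And>A. A \<in> D \<Longrightarrow> f A = g A"
  shows "sigma_additive_on D f \<longleftrightarrow> sigma_additive_on D g"
proof -
  have "((\<lambda>i. f (P i)) has_sum f A) I \<longleftrightarrow> ((\<lambda>i. g (P i)) has_sum g A) I"
    if "A \<in> D" "\<forall>i\<in>I. P i \<in> D" for A and I :: "nat set" and P
  proof -
    have "((\<lambda>i. f (P i)) has_sum f A) I \<longleftrightarrow> ((\<lambda>i. g (P i)) has_sum f A) I"
      using that by (intro has_sum_cong) (simp add: assms)
    with assms[OF that(1)] show ?thesis
      by simp
  qed
  then show ?thesis
    unfolding sigma_additive_on_def by (intro ball_cong all_cong) auto
qed

lemma sigma_additive_on_Un:
  assumes f: "sigma_additive_on D f"
    and "A \<in> D" "B \<in> D" "A \<union> B \<in> D" "A \<inter> B = {}"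
  shows "f (A \<union> B) = f A + f B"
proof -
  define P where "P i = (if i = 0 then A else B)" for i :: nat
  have "((\<lambda>i. f (P i)) has_sum f (A \<union> B)) {0, 1}"
    using assms by (intro sigma_additive_onD[OF f]) (auto simp: P_def disjoint_family_on_def)
  moreover have "((\<lambda>i. f (P i)) has_sum f A + f B) {0, 1}"
    using has_sum_finite[of "{0, 1 :: nat}" "\<lambda>i. f (P i)"] by (simp add: P_def)
  ultimately show ?thesis
    by (rule has_sum_unique)
qed

lemma sigma_additive_on_add:
  assumes "sigma_additive_on D f" "sigma_additive_on D g"
  shows "sigma_additive_on D (\<lambda>A. f A + g A)"
  unfolding sigma_additive_on_def
  by (intro ballI allI impI has_sum_add assms[THEN sigma_additive_onD]) auto

lemma sigma_additive_on_comm_additive: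
  fixes f :: "'x set \<Rightarrow> 'a :: {ab_group_add, topological_comm_monoid_add, t2_space}"
    and h :: "'a \<Rightarrow> 'b :: {ab_group_add, topological_comm_monoid_add, t2_space}"
  assumes f: "sigma_additive_on D f" and h: "Modules.additive h" "continuous_on UNIV h"
  shows "sigma_additive_on D (\<lambda>A. h (f A))"
proof -
  have "((\<lambda>i. h (f (P i))) has_sum h x) I" if "((\<lambda>i. f (P i)) has_sum x) I"
    for P and I :: "nat set" and x
    using has_sum_comm_additive[OF h(1) _ that] h(2)
    by (simp add: comp_def continuous_on_eq_continuous_at isCont_def)
  with f show ?thesis
    unfolding sigma_additive_on_def by blast
qed

text \<open>Cut \<open>A\<close> into countably many pieces from \<open>E\<close>; downward closure
  puts them in \<open>D\<close>. Both values are then sums of the same family, and limits are unique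
  in a Hausdorff space.\<close>

lemma (in sigma_ring) sigma_additive_on_eqI:
  assumes f: "sigma_additive_on D f" and g: "sigma_additive_on D g"
    and D: "D \<subseteq> Q" "\<And>A B. A \<in> D \<Longrightarrow> B \<in> Q \<Longrightarrow> B \<subseteq> A \<Longrightarrow> B \<in> D"
    and E: "generating_ideal Q E"
    and eq: "\<And>B. B \<in> D \<Longrightarrow> B \<in> E \<Longrightarrow> f B = g B" and A: "A \<in> D"
  shows "f A = g A"
proof -
  obtain P :: "nat \<Rightarrow> 'x set" where P: "\<And>i. P i \<in> E" "disjoint_family P" "(\<Union>i. P i) = A"
    using generating_ideal_partition[OF E subsetD[OF D(1) A]] by metis
  then have PD: "P i \<in> D" for i
    using D(2)[OF A, of "P i"] E by (auto simp: generating_ideal_def)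
  have "((\<lambda>i. f (P i)) has_sum f A) UNIV" "((\<lambda>i. g (P i)) has_sum g A) UNIV"
    using P PD A by (auto intro!: sigma_additive_onD[OF f] sigma_additive_onD[OF g])
  moreover have "(\<lambda>i. f (P i)) = (\<lambda>i. g (P i))"
    using PD P eq by simp
  ultimately show ?thesis
    by (metis has_sum_unique)
qed

text \<open>The decomposition is that of \<open>sigma_additive_on_eqI\<close>, but here an
  inequality has to survive the limit: differences of partial sums stay in the positive cone, and so
  does their limit.\<close>

lemma (in sigma_ring) sigma_additive_on_leI:
  fixes f g :: "'x set \<Rightarrow> 'a :: {ordered_ab_group_add, topological_ab_group_add, t2_space}"
  assumes cone: "sequentially_closed {x :: 'a. 0 \<le> x}"
    and f: "sigma_additive_on D f" and g: "sigma_additive_on D g"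
    and D: "D \<subseteq> Q" "\<And>A B. A \<in> D \<Longrightarrow> B \<in> Q \<Longrightarrow> B \<subseteq> A \<Longrightarrow> B \<in> D"
    and E: "generating_ideal Q E"
    and le: "\<And>B. B \<in> D \<Longrightarrow> B \<in> E \<Longrightarrow> f B \<le> g B" and A: "A \<in> D"
  shows "f A \<le> g A"
proof -
  obtain P :: "nat \<Rightarrow> 'x set" where P: "\<And>i. P i \<in> E" "disjoint_family P" "(\<Union>i. P i) = A"
    using generating_ideal_partition[OF E subsetD[OF D(1) A]] by metis
  then have PD: "P i \<in> D" for i
    using D(2)[OF A, of "P i"] E by (auto simp: generating_ideal_def)
  have "((\<lambda>i. f (P i)) has_sum f A) UNIV" "((\<lambda>i. g (P i)) has_sum g A) UNIV"
    using P PD A by (auto intro!: sigma_additive_onD[OF f] sigma_additive_onD[OF g])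
  \<comment> \<open>The cone is assumed closed under limits of sequences, so convergence of the net
    is weakened to that of the partial sums over initial segments.\<close>
  then have "(\<lambda>n. \<Sum>i<n. f (P i)) \<longlonglongrightarrow> f A" "(\<lambda>n. \<Sum>i<n. g (P i)) \<longlonglongrightarrow> g A"
    by (auto dest!: has_sum_imp_sums simp: sums_def)
  then have "(\<lambda>n. (\<Sum>i<n. g (P i)) - (\<Sum>i<n. f (P i))) \<longlonglongrightarrow> g A - f A"
    by (intro tendsto_diff)
  moreover have "(\<Sum>i<n. f (P i)) \<le> (\<Sum>i<n. g (P i))" for n
    using PD P le by (intro sum_mono) auto
  ultimately have "g A - f A \<in> {x. 0 \<le> x}"
    using cone unfolding sequentially_closed_def
    by (metis (no_types, lifting) diff_ge_0_iff_ge mem_Collect_eq)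
  then show ?thesis
    by simp
qed

section \<open>The measure generated by a premeasure\<close>

context sigma_ring
begin

definition premeasures_on ::
  "('x set \<rightharpoonup> 'a :: {topological_comm_monoid_add, t2_space}) set" where
  "premeasures_on = {\<mu>. premeasure \<mu> \<and> host_sigma_ring \<mu> = Q}"

lemma premeasures_on_iff:
  "\<mu> \<in> premeasures_on \<longleftrightarrow>
     generating_ideal Q (dom \<mu>) \<and> sigma_additive_on (dom \<mu>) (\<lambda>A. the (\<mu> A))"
  unfolding premeasures_on_def premeasure_def host_sigma_ring_def sigma_additive_on_def
    generating_ideal_iff by blast

text \<open>Both hosts are \<open>Q\<close>, so similarity reduces to agreement on the common
  domain.\<close>

lemma measures_on_iff:
  "\<mu> \<in> measures_on Q \<longleftrightarrow> \<mu> \<in> premeasures_on \<and>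
     (\<forall>\<nu>\<in>premeasures_on. (\<forall>A \<in> dom \<mu> \<inter> dom \<nu>. \<mu> A = \<nu> A) \<longrightarrow> \<nu> \<subseteq>\<^sub>m \<mu>)"
  unfolding measures_on_def maximal_measure_def premeasures_on_def similar_def
  by (auto simp: eq_commute Int_commute)

lemma measures_on_premeasures_on: "\<mu> \<in> measures_on Q \<Longrightarrow> \<mu> \<in> premeasures_on"
  by (simp add: measures_on_iff)

lemma premeasures_on_ideal:
  assumes "\<mu> \<in> premeasures_on"
  shows "dom \<mu> \<subseteq> Q" "A \<in> dom \<mu> \<Longrightarrow> B \<in> Q \<Longrightarrow> B \<subseteq> A \<Longrightarrow> B \<in> dom \<mu>"
  using assms generating_idealD(1,4)[of Q "dom \<mu>"] by (auto simp: premeasures_on_iff)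

lemma dom_Int_generating:
  "\<mu> \<in> premeasures_on \<Longrightarrow> \<nu> \<in> premeasures_on \<Longrightarrow> generating_ideal Q (dom \<mu> \<inter> dom \<nu>)"
  by (simp add: premeasures_on_iff generating_ideal_Int)

text \<open>On the common domain both maps are countably additive and
  \<open>sigma_additive_on_eqI\<close> applies. Taking for \<open>E\<close> the domain of a third
  premeasure similar to both yields transitivity of similarity.\<close>

lemma premeasures_eqI:
  assumes \<mu>: "\<mu> \<in> premeasures_on" and \<nu>: "\<nu> \<in> premeasures_on" and E: "generating_ideal Q E"
    and eq: "\<And>A. A \<in> dom \<mu> \<Longrightarrow> A \<in> dom \<nu> \<Longrightarrow> A \<in> E \<Longrightarrow> \<mu> A = \<nu> A"
    and A: "A \<in> dom \<mu>" "A \<in> dom \<nu>"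
  shows "\<mu> A = \<nu> A"
proof -
  have "the (\<mu> A) = the (\<nu> A)"
  proof (rule sigma_additive_on_eqI[where D = "dom \<mu> \<inter> dom \<nu>", OF _ _ _ _ E])
    show "sigma_additive_on (dom \<mu> \<inter> dom \<nu>) (\<lambda>A. the (\<mu> A))"
      "sigma_additive_on (dom \<mu> \<inter> dom \<nu>) (\<lambda>A. the (\<nu> A))"
      using \<mu> \<nu> by (auto simp: premeasures_on_iff intro: sigma_additive_on_subset)
    show "dom \<mu> \<inter> dom \<nu> \<subseteq> Q"
      using premeasures_on_ideal(1)[OF \<mu>] by blast
    show "B \<in> dom \<mu> \<inter> dom \<nu>" if "A \<in> dom \<mu> \<inter> dom \<nu>" "B \<in> Q" "B \<subseteq> A" for A B
      using that premeasures_on_ideal(2)[OF \<mu>] premeasures_on_ideal(2)[OF \<nu>] by (metis IntD1 IntD2 IntI)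
    show "the (\<mu> B) = the (\<nu> B)" if "B \<in> dom \<mu> \<inter> dom \<nu>" "B \<in> E" for B
      using eq that by simp
    show "A \<in> dom \<mu> \<inter> dom \<nu>"
      using A by simp
  qed
  with A show ?thesis
    by auto
qed

text \<open>Agreement on \<open>E\<close> already makes the two maps similar; by maximality each
  then extends the other. Equations between measures thus need checking only where every term is
  computed pointwise.\<close>

lemma measures_eqI:
  assumes \<mu>: "\<mu> \<in> measures_on Q" and \<nu>: "\<nu> \<in> measures_on Q" and E: "generating_ideal Q E"
    and eq: "\<And>A. A \<in> dom \<mu> \<Longrightarrow> A \<in> dom \<nu> \<Longrightarrow> A \<in> E \<Longrightarrow> \<mu> A = \<nu> A"
  shows "\<mu> = \<nu>"
proof -
  have "\<mu> A = \<nu> A" if "A \<in> dom \<mu>" "A \<in> dom \<nu>" for A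
    using premeasures_eqI[OF _ _ E eq that] \<mu> \<nu> by (blast intro: measures_on_premeasures_on)
  then have "\<mu> \<subseteq>\<^sub>m \<nu>" "\<nu> \<subseteq>\<^sub>m \<mu>"
    using \<mu> \<nu> by (simp_all add: measures_on_iff)
  then show ?thesis
    by (rule map_le_antisym)
qed

text \<open>Any premeasure similar to \<open>\<mu>\<close> and defined at \<open>A\<close> provides
  such an \<open>f\<close>. Its existence is therefore necessary for \<open>A\<close> to lie in the
  domain of the measure sought, and it turns out to be sufficient.\<close>

definition local_extension ::
  "('x set \<rightharpoonup> 'a :: {topological_comm_monoid_add, t2_space}) \<Rightarrow> 'x set \<Rightarrow> ('x set \<Rightarrow> 'a) \<Rightarrow> bool" where
  "local_extension \<mu> A f \<longleftrightarrow> A \<in> Q \<and> sigma_additive_on {B\<in>Q. B \<subseteq> A} f \<and>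
     (\<forall>B\<in>dom \<mu>. B \<subseteq> A \<longrightarrow> f B = the (\<mu> B))"

text \<open>For \<open>\<mu>\<close> in \<open>premeasures_on\<close> the value at \<open>A\<close>
  is independent of the chosen \<open>f\<close>, by \<open>local_extension_unique\<close>.\<close>

definition largest_extension ::
  "('x set \<rightharpoonup> 'a :: {topological_comm_monoid_add, t2_space}) \<Rightarrow> ('x set \<rightharpoonup> 'a)" where
  "largest_extension \<mu> =
     (\<lambda>A. if \<exists>f. local_extension \<mu> A f then Some ((SOME f. local_extension \<mu> A f) A) else None)"

lemma local_extension_subset:
  assumes "local_extension \<mu> A f" "B \<in> Q" "B \<subseteq> A"
  shows "local_extension \<mu> B f"
proof -
  have "{C \<in> Q. C \<subseteq> B} \<subseteq> {C \<in> Q. C \<subseteq> A}"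
    using assms by blast
  then show ?thesis
    using assms unfolding local_extension_def by (blast intro: sigma_additive_on_subset)
qed

lemma local_extension_unique:
  assumes \<mu>: "\<mu> \<in> premeasures_on" and f: "local_extension \<mu> A f" and g: "local_extension \<mu> A g"
  shows "f A = g A"
proof (rule sigma_additive_on_eqI[where D = "{B\<in>Q. B \<subseteq> A}" and E = "dom \<mu>"])
  show "generating_ideal Q (dom \<mu>)"
    using \<mu> by (simp add: premeasures_on_iff)
qed (use f g in \<open>auto simp: local_extension_def\<close>)

lemma largest_extension_eq:
  assumes "\<mu> \<in> premeasures_on" "local_extension \<mu> A f"
  shows "largest_extension \<mu> A = Some (f A)"
proof -
  have "local_extension \<mu> A (SOME f. local_extension \<mu> A f)"
    using assms(2) by (rule someI[of "local_extension \<mu> A"])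
  then show ?thesis
    using assms local_extension_unique unfolding largest_extension_def by auto
qed

lemma dom_largest_extension: "dom (largest_extension \<mu>) = {A. \<exists>f. local_extension \<mu> A f}"
  by (auto simp: largest_extension_def split: if_splits)

lemma local_extension_dom:
  assumes \<mu>: "\<mu> \<in> premeasures_on" and A: "A \<in> dom \<mu>"
  shows "local_extension \<mu> A (\<lambda>B. the (\<mu> B))"
proof -
  have "{B \<in> Q. B \<subseteq> A} \<subseteq> dom \<mu>"
    using premeasures_on_ideal(2)[OF \<mu> A] by blast
  then show ?thesis
    using \<mu> A premeasures_on_ideal(1)[OF \<mu>] unfolding local_extension_def premeasures_on_iff
    by (blast intro: sigma_additive_on_subset)
qed

lemma largest_extension_extends:
  assumes \<mu>: "\<mu> \<in> premeasures_on"
  shows "\<mu> \<subseteq>\<^sub>m largest_extension \<mu>"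
  unfolding map_le_def
proof
  fix A assume A: "A \<in> dom \<mu>"
  show "\<mu> A = largest_extension \<mu> A"
    using largest_extension_eq[OF \<mu> local_extension_dom[OF \<mu> A]] A by auto
qed

text \<open>Each \<open>C\<close> is split along \<open>A\<close>: \<open>f\<close> handles
  \<open>C \<inter> A\<close>, and \<open>g\<close> handles \<open>C - A\<close>, which lies in
  \<open>B\<close>. Subtracting \<open>A\<close> prevents double counting on the overlap. This makes
  the domain of \<open>largest_extension\<close> closed under unions.\<close>

lemma local_extension_Un:
  assumes \<mu>: "\<mu> \<in> premeasures_on" and f: "local_extension \<mu> A f" and g: "local_extension \<mu> B g"
  shows "local_extension \<mu> (A \<union> B) (\<lambda>C. f (C \<inter> A) + g (C - A))"
  unfolding local_extension_def
proof (intro conjI ballI impI)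
  have A: "A \<in> Q" and B: "B \<in> Q"
    using f g by (auto simp: local_extension_def)
  then show "A \<union> B \<in> Q"
    by (rule Un_in)
  show "sigma_additive_on {C \<in> Q. C \<subseteq> A \<union> B} (\<lambda>C. f (C \<inter> A) + g (C - A))"
    unfolding sigma_additive_on_def
  proof (intro ballI allI impI)
    fix C and I :: "nat set" and P
    assume C: "C \<in> {C \<in> Q. C \<subseteq> A \<union> B}"
      and "(\<forall>i\<in>I. P i \<in> {C \<in> Q. C \<subseteq> A \<union> B}) \<and> disjoint_family_on P I \<and> (\<Union>i\<in>I. P i) = C"
    then have P: "\<And>i. i \<in> I \<Longrightarrow> P i \<in> Q \<and> P i \<subseteq> A \<union> B" "disjoint_family_on P I"
      "(\<Union>i\<in>I. P i) = C"
      by blast+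
    have "((\<lambda>i. f (P i \<inter> A)) has_sum f (C \<inter> A)) I"
    proof (rule sigma_additive_onD)
      show "sigma_additive_on {C \<in> Q. C \<subseteq> A} f"
        using f by (simp add: local_extension_def)
      show "disjoint_family_on (\<lambda>i. P i \<inter> A) I"
        using P(2) unfolding disjoint_family_on_def by blast
    qed (use A C P in \<open>auto intro: Int_in\<close>)
    moreover have "((\<lambda>i. g (P i - A)) has_sum g (C - A)) I"
    proof (rule sigma_additive_onD)
      show "sigma_additive_on {C \<in> Q. C \<subseteq> B} g"
        using g by (simp add: local_extension_def)
      show "P i - A \<in> {C \<in> Q. C \<subseteq> B}" if "i \<in> I" for i
        using P(1)[OF that] A by (auto intro: Diff_in)
      show "disjoint_family_on (\<lambda>i. P i - A) I"
        using P(2) unfolding disjoint_family_on_def by blast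
    qed (use A C P(3) in \<open>auto intro: Diff_in\<close>)
    ultimately show "((\<lambda>i. f (P i \<inter> A) + g (P i - A)) has_sum f (C \<inter> A) + g (C - A)) I"
      by (rule has_sum_add)
  qed
  fix C assume C: "C \<in> dom \<mu>" "C \<subseteq> A \<union> B"
  then have "C \<in> Q"
    using premeasures_on_ideal(1)[OF \<mu>] by blast
  then have dom: "C \<inter> A \<in> dom \<mu>" "C - A \<in> dom \<mu>"
    using premeasures_on_ideal(2)[OF \<mu> C(1)] A by (auto intro: Int_in Diff_in)
  have "the (\<mu> (C \<inter> A \<union> (C - A))) = the (\<mu> (C \<inter> A)) + the (\<mu> (C - A))"
    using \<mu> C dom by (intro sigma_additive_on_Un[of "dom \<mu>"]) (auto simp: premeasures_on_iff Int_Diff_Un)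
  moreover have "f (C \<inter> A) = the (\<mu> (C \<inter> A))"
    using f dom by (simp add: local_extension_def)
  moreover have "C - A \<subseteq> B"
    using C by blast
  then have "g (C - A) = the (\<mu> (C - A))"
    using g dom by (simp add: local_extension_def)
  ultimately show "f (C \<inter> A) + g (C - A) = the (\<mu> C)"
    by (simp add: Int_Diff_Un)
qed

text \<open>Additivity at \<open>A\<close> comes from a single \<open>f\<close> that serves
  \<open>A\<close> and all pieces. Maximality holds because a premeasure agreeing with the extension
  is itself a local extension at each set of its domain.\<close>

lemma largest_extension_measures_on:
  assumes \<mu>: "\<mu> \<in> premeasures_on"
  shows "largest_extension \<mu> \<in> measures_on Q"
  unfolding measures_on_iff
proof (intro conjI ballI impI)
  let ?D = "dom (largest_extension \<mu>)"
  have sub: "dom \<mu> \<subseteq> ?D"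
    using largest_extension_extends[OF \<mu>] by (rule map_le_implies_dom_le)
  have gen: "generating_ideal Q ?D"
    unfolding generating_ideal_def
  proof (intro conjI ballI impI)
    show "?D \<subseteq> Q"
      by (auto simp: dom_largest_extension local_extension_def)
    show "{} \<in> ?D"
      using sub \<mu> by (auto simp: premeasures_on_iff generating_ideal_def)
    show "A \<union> B \<in> ?D" if "A \<in> ?D" "B \<in> ?D" for A B
      using that local_extension_Un[OF \<mu>] unfolding dom_largest_extension by blast
    show "B \<in> ?D" if "A \<in> ?D" "B \<in> Q" "B \<subseteq> A" for A B
      using that local_extension_subset[of \<mu> A _ B] unfolding dom_largest_extension by blast
    show "\<exists>C\<subseteq>?D. countable C \<and> W \<subseteq> \<Union>C" if "W \<in> Q" for W
    proof -
      have "generating_ideal Q (dom \<mu>)"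
        using \<mu> by (simp add: premeasures_on_iff)
      from generating_idealD(5)[OF this that] obtain C
        where "C \<subseteq> dom \<mu> \<and> countable C \<and> W \<subseteq> \<Union>C" ..
      with sub show ?thesis
        by (intro exI[of _ C]) (simp add: subset_trans[of C "dom \<mu>"])
    qed
  qed
  have "sigma_additive_on ?D (\<lambda>A. the (largest_extension \<mu> A))"
    unfolding sigma_additive_on_def
  proof (intro ballI allI impI)
    fix A and I :: "nat set" and P
    assume A: "A \<in> ?D"
      and P: "(\<forall>i\<in>I. P i \<in> ?D) \<and> disjoint_family_on P I \<and> (\<Union>i\<in>I. P i) = A"
    obtain f where f: "local_extension \<mu> A f"
      using A by (auto simp: dom_largest_extension)
    have PQ: "P i \<in> Q" "P i \<subseteq> A" if "i \<in> I" for i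
      using P that gen by (auto simp: generating_ideal_def)
    have "((\<lambda>i. f (P i)) has_sum f A) I"
      using f P PQ by (intro sigma_additive_onD[of "{B \<in> Q. B \<subseteq> A}"]) (auto simp: local_extension_def)
    \<comment> \<open>The same \<open>f\<close> restricts to a local extension at every piece, and
      uniqueness identifies its value there with the chosen one.\<close>
    moreover have "largest_extension \<mu> (P i) = Some (f (P i))" if "i \<in> I" for i
      using largest_extension_eq[OF \<mu> local_extension_subset[OF f PQ[OF that]]] .
    ultimately have "((\<lambda>i. the (largest_extension \<mu> (P i))) has_sum f A) I"
      by (simp cong: has_sum_cong)
    then show "((\<lambda>i. the (largest_extension \<mu> (P i))) has_sum the (largest_extension \<mu> A)) I"
      by (simp add: largest_extension_eq[OF \<mu> f])
  qed
  with gen show pre: "largest_extension \<mu> \<in> premeasures_on"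
    by (simp add: premeasures_on_iff)
  fix \<nu> :: "'x set \<rightharpoonup> 'a" assume \<nu>: "\<nu> \<in> premeasures_on"
    and eq: "\<forall>A\<in>?D \<inter> dom \<nu>. largest_extension \<mu> A = \<nu> A"
  show "\<nu> \<subseteq>\<^sub>m largest_extension \<mu>"
    unfolding map_le_def
  proof
    fix A assume A: "A \<in> dom \<nu>"
    \<comment> \<open>Here \<open>\<nu>\<close> itself is the witness: a set \<open>B\<close> in
      \<open>dom \<mu>\<close> below \<open>A\<close> lies in \<open>dom \<nu>\<close> by the ideal
      property, and there \<open>\<nu>\<close> agrees with the extension, hence with
      \<open>\<mu>\<close>.\<close>
    have "local_extension \<mu> A (\<lambda>B. the (\<nu> B))"
      unfolding local_extension_def
    proof (intro conjI ballI impI)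
      show "A \<in> Q" "sigma_additive_on {B \<in> Q. B \<subseteq> A} (\<lambda>B. the (\<nu> B))"
        using local_extension_dom[OF \<nu> A] by (auto simp: local_extension_def)
      fix B assume B: "B \<in> dom \<mu>" "B \<subseteq> A"
      then have "B \<in> dom \<nu>"
        using premeasures_on_ideal(1)[OF \<mu>] premeasures_on_ideal(2)[OF \<nu> A] by blast
      moreover have "\<mu> B = largest_extension \<mu> B"
        using largest_extension_extends[OF \<mu>] B by (auto simp: map_le_def)
      ultimately show "the (\<nu> B) = the (\<mu> B)"
        using eq B sub by (metis IntI subsetD)
    qed
    then show "\<nu> A = largest_extension \<mu> A"
      using largest_extension_eq[OF \<mu>, of A "\<lambda>B. the (\<nu> B)"] A by auto
  qed
qed

text \<open>\<open>largest_extension\<close> shows existence and \<open>measures_eqI\<close> on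
  \<open>dom \<mu>\<close> uniqueness, so the definite description is legitimate. These two facts
  are all that is used about it afterwards.\<close>

lemma generated_measure:
  assumes \<mu>: "\<mu> \<in> premeasures_on"
  shows "generated_measure \<mu> \<in> measures_on Q" "\<mu> \<subseteq>\<^sub>m generated_measure \<mu>"
proof -
  have iff: "maximal_measure \<nu> \<and> similar \<nu> \<mu> \<longleftrightarrow>
      \<nu> \<in> measures_on Q \<and> (\<forall>A \<in> dom \<nu> \<inter> dom \<mu>. \<nu> A = \<mu> A)" for \<nu>
    using \<mu> by (auto simp: measures_on_def similar_def premeasures_on_def)
  have extends: "\<mu> \<subseteq>\<^sub>m largest_extension \<mu>" "largest_extension \<mu> \<in> measures_on Q"
    using \<mu> by (rule largest_extension_extends largest_extension_measures_on)+
  have "generated_measure \<mu> = largest_extension \<mu>"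
    unfolding generated_measure_def iff
  proof (rule the_equality)
    show "largest_extension \<mu> \<in> measures_on Q \<and>
        (\<forall>A \<in> dom (largest_extension \<mu>) \<inter> dom \<mu>. largest_extension \<mu> A = \<mu> A)"
      using extends by (auto simp: map_le_def)
    fix \<nu> assume \<nu>: "\<nu> \<in> measures_on Q \<and> (\<forall>A \<in> dom \<nu> \<inter> dom \<mu>. \<nu> A = \<mu> A)"
    show "\<nu> = largest_extension \<mu>"
    proof (rule measures_eqI[where E = "dom \<mu>"])
      show "\<nu> A = largest_extension \<mu> A" if "A \<in> dom \<nu>" "A \<in> dom \<mu>" for A
        using \<nu> that extends(1) by (auto simp: map_le_def)
    qed (use \<nu> extends \<mu> in \<open>auto simp: premeasures_on_iff\<close>)
  qed
  with extends show "generated_measure \<mu> \<in> measures_on Q" "\<mu> \<subseteq>\<^sub>m generated_measure \<mu>"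
    by simp_all
qed

section \<open>Operations on measures\<close>

lemma pointwise_add_premeasures_on:
  assumes \<mu>: "\<mu> \<in> premeasures_on" and \<nu>: "\<nu> \<in> premeasures_on"
  shows "pointwise_add \<mu> \<nu> \<in> premeasures_on"
proof -
  have dom: "dom (pointwise_add \<mu> \<nu>) = dom \<mu> \<inter> dom \<nu>"
    by (auto simp: pointwise_add_def split: if_splits)
  have "sigma_additive_on (dom \<mu> \<inter> dom \<nu>) (\<lambda>A. the (\<mu> A) + the (\<nu> A))"
    using \<mu> \<nu> by (intro sigma_additive_on_add) (auto simp: premeasures_on_iff intro: sigma_additive_on_subset)
  also have "?this \<longleftrightarrow> sigma_additive_on (dom \<mu> \<inter> dom \<nu>) (\<lambda>A. the (pointwise_add \<mu> \<nu> A))"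
    by (intro sigma_additive_on_cong) (simp add: pointwise_add_def)
  finally show ?thesis
    using dom_Int_generating[OF \<mu> \<nu>] by (simp add: premeasures_on_iff dom)
qed

lemma measure_add_measures_on:
  assumes "\<mu> \<in> measures_on Q" "\<nu> \<in> measures_on Q"
  shows "measure_add \<mu> \<nu> \<in> measures_on Q"
  unfolding measure_add_def
  using assms by (intro generated_measure pointwise_add_premeasures_on measures_on_premeasures_on)

text \<open>The sum may be defined on further sets, but comparisons through a generating ideal ask
  only for its values on the common domain.\<close>

lemma measure_add_apply:
  assumes "\<mu> \<in> measures_on Q" "\<nu> \<in> measures_on Q" "\<mu> A = Some x" "\<nu> A = Some y"
  shows "measure_add \<mu> \<nu> A = Some (x + y)"
proof -
  have "pointwise_add \<mu> \<nu> \<subseteq>\<^sub>m measure_add \<mu> \<nu>"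
    unfolding measure_add_def
    using assms by (intro generated_measure pointwise_add_premeasures_on measures_on_premeasures_on)
  moreover have "pointwise_add \<mu> \<nu> A = Some (x + y)"
    using assms(3,4) by (auto simp: pointwise_add_def)
  ultimately show ?thesis
    by (metis domI map_le_def)
qed

text \<open>The domain is all of \<open>Q\<close>, which contains the domain of every premeasure
  with host \<open>Q\<close>; maximality follows at once.\<close>

lemma zero_measures_on:
  "(\<lambda>A. if A \<in> Q then Some (0 :: 'a :: {topological_comm_monoid_add, t2_space}) else None)
     \<in> measures_on Q" (is "?z \<in> _")
proof -
  have dom: "dom ?z = Q"
    by (auto split: if_splits)
  have "sigma_additive_on Q (\<lambda>A. the (?z A))"
    by (auto simp: sigma_additive_on_def intro!: has_sum_0)
  then have "?z \<in> premeasures_on"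
    by (simp add: premeasures_on_iff dom generating_ideal_self)
  moreover have "\<nu> \<subseteq>\<^sub>m ?z"
    if "\<nu> \<in> premeasures_on" "\<forall>A \<in> dom ?z \<inter> dom \<nu>. ?z A = \<nu> A" for \<nu>
    using that premeasures_on_ideal(1)[of \<nu>] unfolding map_le_def dom by (metis IntI subsetD)
  ultimately show ?thesis
    by (simp add: measures_on_iff)
qed

end

lemma reflp_on_measure_le: "reflp_on M (measure_le :: ('x set \<rightharpoonup> 'a :: preorder) \<Rightarrow> _)"
  by (simp add: reflp_on_def measure_le_def)

section \<open>Scalar multiples, the order axioms and the vector space axioms\<close>

context sigma_ring
begin

context
  assumes cone: "sequentially_closed
      {x :: 'a :: {ordered_real_vector, topological_ab_group_add, t2_space}. 0 \<le> x}"
    and continuous_scaleR: "\<And>k :: real. continuous_on UNIV (\<lambda>x :: 'a. k *\<^sub>R x)"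
begin

abbreviation M :: "('x set \<rightharpoonup> 'a) set" where
  "M \<equiv> measures_on Q"

abbreviation zero_measure :: "'x set \<rightharpoonup> 'a" where
  "zero_measure \<equiv> (\<lambda>A. if A \<in> Q then Some 0 else None)"

lemma pointwise_scale_premeasures_on:
  fixes \<mu> :: "'x set \<rightharpoonup> 'a"
  assumes \<mu>: "\<mu> \<in> premeasures_on"
  shows "pointwise_scale k \<mu> \<in> premeasures_on"
proof -
  have dom: "dom (pointwise_scale k \<mu>) = dom \<mu>"
    by (auto simp: pointwise_scale_def)
  have "Modules.additive (\<lambda>x :: 'a. k *\<^sub>R x)"
    by (simp add: Modules.additive_def scaleR_add_right)
  moreover have "sigma_additive_on (dom \<mu>) (\<lambda>A. the (\<mu> A))"
    using \<mu> by (simp add: premeasures_on_iff)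
  ultimately have "sigma_additive_on (dom \<mu>) (\<lambda>A. k *\<^sub>R the (\<mu> A))"
    using continuous_scaleR[of k]
    by (intro sigma_additive_on_comm_additive[where h = "\<lambda>x. k *\<^sub>R x"])
  also have "?this \<longleftrightarrow> sigma_additive_on (dom \<mu>) (\<lambda>A. the (pointwise_scale k \<mu> A))"
    by (intro sigma_additive_on_cong) (auto simp: pointwise_scale_def)
  finally show ?thesis
    using \<mu> by (simp add: premeasures_on_iff dom)
qed

lemma measure_scale_measures_on: "\<mu> \<in> M \<Longrightarrow> measure_scale k \<mu> \<in> M"
  unfolding measure_scale_def
  by (intro generated_measure pointwise_scale_premeasures_on measures_on_premeasures_on)

lemma measure_scale_apply:
  assumes "\<mu> \<in> M" "\<mu> A = Some x"
  shows "measure_scale k \<mu> A = Some (k *\<^sub>R x)"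
proof -
  have "pointwise_scale k \<mu> \<subseteq>\<^sub>m measure_scale k \<mu>"
    unfolding measure_scale_def
    using assms by (intro generated_measure pointwise_scale_premeasures_on measures_on_premeasures_on)
  moreover have "pointwise_scale k \<mu> A = Some (k *\<^sub>R x)"
    using assms(2) by (auto simp: pointwise_scale_def)
  ultimately show ?thesis
    by (metis domI map_le_def)
qed

lemmas closed = measure_add_measures_on measure_scale_measures_on zero_measures_on
lemmas apply_simps = measure_add_apply measure_scale_apply

text \<open>Sequential closedness of the cone enters here: through
  \<open>sigma_additive_on_leI\<close> an inequality on a generating ideal spreads to the whole
  common domain.\<close>

lemma measure_leI:
  assumes \<mu>: "\<mu> \<in> M" and \<nu>: "\<nu> \<in> M" and E: "generating_ideal Q E"
    and le: "\<And>A x y. A \<in> E \<Longrightarrow> \<mu> A = Some x \<Longrightarrow> \<nu> A = Some y \<Longrightarrow> x \<le> y"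
  shows "measure_le \<mu> \<nu>"
  unfolding measure_le_def
proof
  fix A assume A: "A \<in> dom \<mu> \<inter> dom \<nu>"
  have pre: "\<mu> \<in> premeasures_on" "\<nu> \<in> premeasures_on"
    using \<mu> \<nu> by (simp_all add: measures_on_premeasures_on)
  show "the (\<mu> A) \<le> the (\<nu> A)"
  proof (rule sigma_additive_on_leI[where D = "dom \<mu> \<inter> dom \<nu>", OF cone _ _ _ _ E])
    show "sigma_additive_on (dom \<mu> \<inter> dom \<nu>) (\<lambda>A. the (\<mu> A))"
      "sigma_additive_on (dom \<mu> \<inter> dom \<nu>) (\<lambda>A. the (\<nu> A))"
      using pre by (auto simp: premeasures_on_iff intro: sigma_additive_on_subset)
    show "dom \<mu> \<inter> dom \<nu> \<subseteq> Q"
      using premeasures_on_ideal(1)[OF pre(1)] by blast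
    show "B \<in> dom \<mu> \<inter> dom \<nu>" if "A \<in> dom \<mu> \<inter> dom \<nu>" "B \<in> Q" "B \<subseteq> A" for A B
      using that premeasures_on_ideal(2)[OF pre(1)] premeasures_on_ideal(2)[OF pre(2)]
      by (metis IntD1 IntD2 IntI)
    show "the (\<mu> B) \<le> the (\<nu> B)" if "B \<in> dom \<mu> \<inter> dom \<nu>" "B \<in> E" for B
      using le that by auto
  qed (rule A)
qed

lemma measure_leD: "measure_le \<mu> \<nu> \<Longrightarrow> \<mu> A = Some x \<Longrightarrow> \<nu> A = Some y \<Longrightarrow> x \<le> y"
  unfolding measure_le_def by (metis IntI domI option.sel)

lemma dom_generating: "\<mu> \<in> M \<Longrightarrow> generating_ideal Q (dom \<mu>)"
  by (drule measures_on_premeasures_on) (simp add: premeasures_on_iff)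

text \<open>\<open>\<mu>\<close> and \<open>\<rho>\<close> may share sets outside
  \<open>dom \<nu>\<close>, where the middle term is missing. The inequalities are chained on
  \<open>dom \<nu>\<close> and spread by \<open>measure_leI\<close>.\<close>

lemma transp_on_measure_le: "transp_on M measure_le"
proof (rule transp_onI)
  fix \<mu> \<nu> \<rho> assume M: "\<mu> \<in> M" "\<nu> \<in> M" "\<rho> \<in> M" and le: "measure_le \<mu> \<nu>" "measure_le \<nu> \<rho>"
  show "measure_le \<mu> \<rho>"
    using M(1,3) dom_generating[OF M(2)]
    by (rule measure_leI) (use le in \<open>blast dest: measure_leD intro: order_trans\<close>)
qed

text \<open>Two-sided inequalities give equal values on the common domain;
  \<open>measures_eqI\<close> with \<open>E\<close> equal to \<open>Q\<close> then also identifies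
  the domains.\<close>

lemma antisymp_on_measure_le: "antisymp_on M measure_le"
proof (rule antisymp_onI)
  fix \<mu> \<nu> assume M: "\<mu> \<in> M" "\<nu> \<in> M" and le: "measure_le \<mu> \<nu>" "measure_le \<nu> \<mu>"
  show "\<mu> = \<nu>"
    using M generating_ideal_self
  proof (rule measures_eqI)
    fix A assume "A \<in> dom \<mu>" "A \<in> dom \<nu>"
    then obtain a b where "\<mu> A = Some a" "\<nu> A = Some b"
      by blast
    then show "\<mu> A = \<nu> A"
      using measure_leD[OF le(1)] measure_leD[OF le(2)] by (simp add: order_antisym)
  qed
qed

text \<open>Both sums are pointwise where all three measures are defined, and that intersection
  still generates \<open>Q\<close>.\<close>

lemma measure_add_mono:
  assumes M: "\<mu> \<in> M" "\<nu> \<in> M" "\<rho> \<in> M" and le: "measure_le \<mu> \<nu>"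
  shows "measure_le (measure_add \<mu> \<rho>) (measure_add \<nu> \<rho>)"
proof (rule measure_leI[where E = "dom \<mu> \<inter> (dom \<nu> \<inter> dom \<rho>)"])
  fix A x y
  assume "A \<in> dom \<mu> \<inter> (dom \<nu> \<inter> dom \<rho>)"
  then obtain a b c where "\<mu> A = Some a" "\<nu> A = Some b" "\<rho> A = Some c"
    by blast
  moreover assume "measure_add \<mu> \<rho> A = Some x" "measure_add \<nu> \<rho> A = Some y"
  ultimately show "x \<le> y"
    using M measure_leD[OF le, of A a b] by (auto simp: apply_simps)
qed (use M in \<open>auto intro: closed dom_generating generating_ideal_Int\<close>)

lemma measure_scale_nonneg:
  assumes M: "\<mu> \<in> M" and k: "0 \<le> k" and le: "measure_le zero_measure \<mu>"
  shows "measure_le zero_measure (measure_scale k \<mu>)"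
proof (rule measure_leI[where E = "dom \<mu>"])
  fix A x y
  assume "A \<in> dom \<mu>"
  then obtain a where "\<mu> A = Some a"
    by blast
  moreover assume "zero_measure A = Some x" "measure_scale k \<mu> A = Some y"
  ultimately show "x \<le> y"
    using M k measure_leD[OF le, of A 0 a]
    by (auto simp: apply_simps scaleR_nonneg_nonneg split: if_splits)
qed (use M in \<open>auto intro: closed dom_generating\<close>)

text \<open>On the intersection of the domains of the measures involved, each equational axiom
  becomes the same axiom in the value space, and \<open>measures_eqI\<close> concludes.\<close>

lemma module_measures_on:
  "Module.module (ring_of_type_algebra :: real ring)
     \<lparr>carrier = M, monoid.mult = undefined, one = undefined,
      zero = zero_measure, add = measure_add, smult = measure_scale\<rparr>"
  (is "Module.module ?R ?V")
proof (rule moduleI)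
  show "cring ?R" ..
  show "abelian_group ?V"
  proof (rule abelian_groupI, goal_cases)
    case (3 \<mu> \<nu> \<rho>)
    then have M: "\<mu> \<in> M" "\<nu> \<in> M" "\<rho> \<in> M"
      by simp_all
    have "measure_add (measure_add \<mu> \<nu>) \<rho> = measure_add \<mu> (measure_add \<nu> \<rho>)"
      by (rule measures_eqI[where E = "dom \<mu> \<inter> (dom \<nu> \<inter> dom \<rho>)"])
        (use M in \<open>auto intro: closed dom_generating generating_ideal_Int
            simp: closed apply_simps add.assoc\<close>)
    then show ?case
      by simp
  next
    case (4 \<mu> \<nu>)
    then have M: "\<mu> \<in> M" "\<nu> \<in> M"
      by simp_all
    have "measure_add \<mu> \<nu> = measure_add \<nu> \<mu>"
      by (rule measures_eqI[where E = "dom \<mu> \<inter> dom \<nu>"])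
        (use M in \<open>auto intro: closed dom_generating generating_ideal_Int
            simp: closed apply_simps add.commute\<close>)
    then show ?case
      by simp
  next
    case (5 \<mu>)
    then have M: "\<mu> \<in> M"
      by simp
    have "measure_add zero_measure \<mu> = \<mu>"
    proof (rule measures_eqI[where E = "dom \<mu>"])
      fix A assume A: "A \<in> dom \<mu>"
      then have "zero_measure A = Some 0"
        using dom_generating[OF M] by (auto simp: generating_ideal_def)
      with A show "measure_add zero_measure \<mu> A = \<mu> A"
        using measure_add_apply[OF zero_measures_on M, of A 0] by auto
    qed (use M in \<open>auto intro: closed dom_generating\<close>)
    then show ?case
      by simp
  next
    case (6 \<mu>)
    then have M: "\<mu> \<in> M"
      by simp
    \<comment> \<open>The pointwise sum is given as zero only on \<open>dom \<mu>\<close>, whereas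
      \<open>zero_measure\<close> is defined on all of \<open>Q\<close>; \<open>measures_eqI\<close>
      bridges the gap by maximality.\<close>
    have "measure_add (measure_scale (- 1) \<mu>) \<mu> = zero_measure"
    proof (rule measures_eqI[where E = "dom \<mu>"])
      fix A assume "A \<in> dom \<mu>" "A \<in> dom zero_measure"
      then show "measure_add (measure_scale (- 1) \<mu>) \<mu> A = zero_measure A"
        using M by (auto simp: closed apply_simps split: if_splits)
    qed (use M in \<open>auto intro: closed dom_generating\<close>)
    then show ?case
      using M by (auto intro!: bexI[of _ "measure_scale (- 1) \<mu>"] closed)
  qed (auto intro: closed)
next
  fix a b :: real and \<mu> assume "\<mu> \<in> carrier ?V"
  then have M: "\<mu> \<in> M"
    by simp
  have "measure_scale (a + b) \<mu> = measure_add (measure_scale a \<mu>) (measure_scale b \<mu>)"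
    by (rule measures_eqI[where E = "dom \<mu>"])
      (use M in \<open>auto intro: closed dom_generating simp: closed apply_simps scaleR_add_left\<close>)
  then show "(a \<oplus>\<^bsub>?R\<^esub> b) \<odot>\<^bsub>?V\<^esub> \<mu> = a \<odot>\<^bsub>?V\<^esub> \<mu> \<oplus>\<^bsub>?V\<^esub> b \<odot>\<^bsub>?V\<^esub> \<mu>"
    by (simp add: ring_of_type_algebra_def)
  have "measure_scale (a * b) \<mu> = measure_scale a (measure_scale b \<mu>)"
    by (rule measures_eqI[where E = "dom \<mu>"])
      (use M in \<open>auto intro: closed dom_generating simp: closed apply_simps\<close>)
  then show "(a \<otimes>\<^bsub>?R\<^esub> b) \<odot>\<^bsub>?V\<^esub> \<mu> = a \<odot>\<^bsub>?V\<^esub> (b \<odot>\<^bsub>?V\<^esub> \<mu>)"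
    by (simp add: ring_of_type_algebra_def)
next
  fix a :: real and \<mu> \<nu> assume "\<mu> \<in> carrier ?V" "\<nu> \<in> carrier ?V"
  then have M: "\<mu> \<in> M" "\<nu> \<in> M"
    by simp_all
  have "measure_scale a (measure_add \<mu> \<nu>) = measure_add (measure_scale a \<mu>) (measure_scale a \<nu>)"
    by (rule measures_eqI[where E = "dom \<mu> \<inter> dom \<nu>"])
      (use M in \<open>auto intro: closed dom_generating generating_ideal_Int
          simp: closed apply_simps scaleR_add_right\<close>)
  then show "a \<odot>\<^bsub>?V\<^esub> (\<mu> \<oplus>\<^bsub>?V\<^esub> \<nu>) = a \<odot>\<^bsub>?V\<^esub> \<mu> \<oplus>\<^bsub>?V\<^esub> a \<odot>\<^bsub>?V\<^esub> \<nu>"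
    by simp
next
  fix \<mu> assume "\<mu> \<in> carrier ?V"
  then have M: "\<mu> \<in> M"
    by simp
  have "measure_scale 1 \<mu> = \<mu>"
    by (rule measures_eqI[where E = "dom \<mu>"])
      (use M in \<open>auto intro: closed dom_generating simp: apply_simps\<close>)
  then show "\<one>\<^bsub>?R\<^esub> \<odot>\<^bsub>?V\<^esub> \<mu> = \<mu>"
    by (simp add: ring_of_type_algebra_def)
qed (auto intro: closed)

end

end

theorem theorem7p18:
  fixes Q :: "'x set set"
  assumes "sequentially_closed
             {x :: 'a :: {ordered_real_vector, topological_ab_group_add, t2_space}. 0 \<le> x}"
    and "\<And>k :: real. continuous_on UNIV (\<lambda>x :: 'a. k *\<^sub>R x)"
    and "sigma_ring_of_sets Q"
  shows "ordered_vector_space_on (measures_on Q :: ('x set \<rightharpoonup> 'a) set)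
           measure_add measure_scale measure_le"
proof -
  interpret sigma_ring Q
    using assms(3) by unfold_locales
  note ordered = transp_on_measure_le antisymp_on_measure_le measure_add_mono measure_scale_nonneg
    module_measures_on
  \<comment> \<open>The zero vector asserted to exist is \<open>zero_measure\<close>, supplied by
    \<open>module_measures_on\<close> together with \<open>measure_scale_nonneg\<close>.\<close>
  show ?thesis
    unfolding ordered_vector_space_on_def
    using reflp_on_measure_le ordered[OF assms(1,2)] by blast
qed

end
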